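(* Let $\mathcal{C}$ be a monoidal category and suppose that a lax monoidal functor $(R,\phi_2,\phi_0):\mathcal{C}^{\mathrm{op}}\to\mathcal{C}$ has a left adjoint $L=R^{\mathrm{op}}$. If the colax monoidal structure $(\psi_2,\psi_0)$ induced on $L$ by the adjunction, namely $\psi_2(X,Y)=\epsilon_{LX\otimes LY}\circ L\phi_2(LX,LY)\circ L(\eta_X\otimes\eta_Y)$ and $\psi_0=\epsilon_{\mathbb{I}^{\mathrm{op}}}\circ L\phi_0$ (with $\eta,\epsilon$ the unit and counit of $L\dashv R$), is specifically $(\phi_2^{\mathrm{op}},\phi_0^{\mathrm{op}})$, then $\overline{R}=(\underline{L})^{\mathrm{op}}$. Moreover, if $\overline{R}$ has a left adjoint, then $(L,R)$ is liftable.
   Context: Objects and morphisms of $\mathcal{C}$ viewed in $\mathcal{C}^{\mathrm{op}}$ are written $X^{\mathrm{op}}$, $f^{\mathrm{op}}$. $\mathcal{C}^{\mathrm{op}}$ is monoidal with $X^{\mathrm{op}}\otimes Y^{\mathrm{op}}=(X\otimes Y)^{\mathrm{op}}$ and unit $\mathbb{I}^{\mathrm{op}}$. For a functor $F$, $F^{\mathrm{op}}X^{\mathrm{op}}=(FX)^{\mathrm{op}}$ and $F^{\mathrm{op}}f^{\mathrm{op}}=(Ff)^{\mathrm{op}}$; if $(F,\phi_2,\phi_0)$ is lax monoidal, then $F^{\mathrm{op}}$ is colax monoidal with structure $\phi_2^{\mathrm{op}}(X^{\mathrm{op}},Y^{\mathrm{op}}):=\phi_2(X,Y)^{\mathrm{op}}$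 and $\phi_0^{\mathrm{op}}$. Here $(\mathcal{C}^{\mathrm{op}})^{\mathrm{op}}$ is identified with $\mathcal{C}$. Associativity and unit constraints are suppressed. $\mathsf{Alg}(\mathcal{A})$ and $\mathsf{Coalg}(\mathcal{A})$ denote the categories of algebra (monoid) and coalgebra (comonoid) objects of a monoidal category $\mathcal{A}$; one identifies $\mathsf{Coalg}(\mathcal{C})^{\mathrm{op}}=\mathsf{Alg}(\mathcal{C}^{\mathrm{op}})$ and $\mathsf{Coalg}(\mathcal{C}^{\mathrm{op}})^{\mathrm{op}}=\mathsf{Alg}(\mathcal{C})$. A lax monoidal functor $R:\mathcal{A}\to\mathcal{B}$ induces $\overline{R}=\mathsf{Alg}(R):\mathsf{Alg}(\mathcal{A})\to\mathsf{Alg}(\mathcal{B})$, $(A,m,u)\mapsto(RA,Rm\circ\phi_2(A,A),Ru\circ\phi_0)$; a colax monoidal functor $(L,\psi_2,\psi_0):\mathcal{B}\to\mathcal{A}$ induces $\underline{L}=\mathsf{Coalg}(L):\mathsf{Coalg}(\mathcal{B})\to\mathsf{Coalg}(\mathcal{A})$, $(C,\Delta,\varepsilon)\mapsto(LC,\psi_2(C,C)\circ L\Delta,\psi_0\circ L\varepsilon)$. If $R$ is lax monoidal with left adjoint $L$ (which is then colax monoidal by the formulas in the statement), the pair $(L,R)$ is called liftable if $\overline{R}$ has a left adjoint and $\underline{L}$ has a right adjoint. *)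

theory Defs
  imports Main
begin

text \<open>
  Categories are presented by hom-families: \<open>Hom C X Y\<close> is the set of arrows from \<open>X\<close> to \<open>Y\<close>,
  and hom-sets for different pairs of objects need not be disjoint. Every operation on arrows
  therefore takes the objects involved as arguments; \<open>cmp C X Y Z g f\<close> is the composite
  of \<open>f : X \<rightarrow> Y\<close> and \<open>g : Y \<rightarrow> Z\<close>. The reason for this choice is that an arrow of
  \<open>Alg(C)\<close> is just an arrow of \<open>C\<close> between the underlying objects, an arrow of \<open>C\<^sup>o\<^sup>p\<close> is just an
  arrow of \<open>C\<close> read backwards; thus the identifications \<open>(C\<^sup>o\<^sup>p)\<^sup>o\<^sup>p = C\<close> and
  \<open>Coalg(C)\<^sup>o\<^sup>p = Alg(C\<^sup>o\<^sup>p)\<close> are plain equalities. In particular \<open>X\<^sup>o\<^sup>p\<close> and \<open>f\<^sup>o\<^sup>p\<close>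
  are \<open>X\<close> and \<open>f\<close> themselves.
\<close>

section \<open>Categories, functors, adjunctions\<close>

record ('o, 'a) cat =
  Ob  :: "'o set"
  Hom :: "'o \<Rightarrow> 'o \<Rightarrow> 'a set"
  idn :: "'o \<Rightarrow> 'a"
  cmp :: "'o \<Rightarrow> 'o \<Rightarrow> 'o \<Rightarrow> 'a \<Rightarrow> 'a \<Rightarrow> 'a"

locale category =
  fixes C :: "('o, 'a) cat"
  assumes idn_in: "X \<in> Ob C \<Longrightarrow> idn C X \<in> Hom C X X"
    and cmp_in: "\<lbrakk>X \<in> Ob C; Y \<in> Ob C; Z \<in> Ob C; f \<in> Hom C X Y; g \<in> Hom C Y Z\<rbrakk>
      \<Longrightarrow> cmp C X Y Z g f \<in> Hom C X Z"
    and cmp_idn_right: "\<lbrakk>X \<in> Ob C; Y \<in> Ob C; f \<in> Hom C X Y\<rbrakk> \<Longrightarrow> cmp C X X Y f (idn C X) = f"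
    and cmp_idn_left: "\<lbrakk>X \<in> Ob C; Y \<in> Ob C; f \<in> Hom C X Y\<rbrakk> \<Longrightarrow> cmp C X Y Y (idn C Y) f = f"
    and cmp_assoc: "\<lbrakk>W \<in> Ob C; X \<in> Ob C; Y \<in> Ob C; Z \<in> Ob C;
        f \<in> Hom C W X; g \<in> Hom C X Y; h \<in> Hom C Y Z\<rbrakk>
      \<Longrightarrow> cmp C W X Z (cmp C X Y Z h g) f = cmp C W Y Z h (cmp C W X Y g f)"

definition op_cat :: "('o, 'a) cat \<Rightarrow> ('o, 'a) cat" where
  "op_cat C = \<lparr>Ob = Ob C, Hom = (\<lambda>X Y. Hom C Y X), idn = idn C,
     cmp = (\<lambda>X Y Z g f. cmp C Z Y X f g)\<rparr>"

record ('o, 'a, 'p, 'b) func =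
  Src  :: "('o, 'a) cat"
  Trg  :: "('p, 'b) cat"
  FOb  :: "'o \<Rightarrow> 'p"
  FHom :: "'o \<Rightarrow> 'o \<Rightarrow> 'a \<Rightarrow> 'b"

locale is_functor =
  fixes F :: "('o, 'a, 'p, 'b) func"
  assumes category_Src: "category (Src F)"
    and category_Trg: "category (Trg F)"
    and FOb_in: "X \<in> Ob (Src F) \<Longrightarrow> FOb F X \<in> Ob (Trg F)"
    and FHom_in: "\<lbrakk>X \<in> Ob (Src F); Y \<in> Ob (Src F); f \<in> Hom (Src F) X Y\<rbrakk>
      \<Longrightarrow> FHom F X Y f \<in> Hom (Trg F) (FOb F X) (FOb F Y)"
    and FHom_idn: "X \<in> Ob (Src F) \<Longrightarrow> FHom F X X (idn (Src F) X) = idn (Trg F) (FOb F X)"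
    and FHom_cmp: "\<lbrakk>X \<in> Ob (Src F); Y \<in> Ob (Src F); Z \<in> Ob (Src F);
        f \<in> Hom (Src F) X Y; g \<in> Hom (Src F) Y Z\<rbrakk>
      \<Longrightarrow> FHom F X Z (cmp (Src F) X Y Z g f)
        = cmp (Trg F) (FOb F X) (FOb F Y) (FOb F Z) (FHom F Y Z g) (FHom F X Y f)"

text \<open>
  Equality of functors: same source and target category, same value on every object and on every
  arrow. (HOL equality of the records would also compare the irrelevant values of the maps
  outside the objects and arrows of the source.)
\<close>

definition func_eq :: "('o, 'a, 'p, 'b) func \<Rightarrow> ('o, 'a, 'p, 'b) func \<Rightarrow> bool" where
  "func_eq F G \<longleftrightarrow> Src F = Src G \<and> Trg F = Trg G
     \<and> (\<forall>X \<in> Ob (Src F). FOb F X = FOb G X)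
     \<and> (\<forall>X \<in> Ob (Src F). \<forall>Y \<in> Ob (Src F). \<forall>f \<in> Hom (Src F) X Y. FHom F X Y f = FHom G X Y f)"

definition op_fun :: "('o, 'a, 'p, 'b) func \<Rightarrow> ('o, 'a, 'p, 'b) func" where
  "op_fun F = \<lparr>Src = op_cat (Src F), Trg = op_cat (Trg F), FOb = FOb F,
     FHom = (\<lambda>X Y f. FHom F Y X f)\<rparr>"

text \<open>\<open>L\<close> is left adjoint to \<open>R\<close>, with unit \<open>\<eta> : 1 \<rightarrow> R L\<close> and counit \<open>\<epsilon> : L R \<rightarrow> 1\<close>.\<close>

locale adjunction =
  fixes L :: "('p, 'b, 'o, 'a) func"
    and R :: "('o, 'a, 'p, 'b) func"
    and \<eta> :: "'p \<Rightarrow> 'b"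
    and \<epsilon> :: "'o \<Rightarrow> 'a"
  assumes functor_L: "is_functor L"
    and functor_R: "is_functor R"
    and Src_L: "Src L = Trg R"
    and Trg_L: "Trg L = Src R"
    and unit_in: "X \<in> Ob (Src L) \<Longrightarrow> \<eta> X \<in> Hom (Src L) X (FOb R (FOb L X))"
    and unit_natural: "\<lbrakk>X \<in> Ob (Src L); Y \<in> Ob (Src L); f \<in> Hom (Src L) X Y\<rbrakk>
      \<Longrightarrow> cmp (Src L) X Y (FOb R (FOb L Y)) (\<eta> Y) f
        = cmp (Src L) X (FOb R (FOb L X)) (FOb R (FOb L Y))
            (FHom R (FOb L X) (FOb L Y) (FHom L X Y f)) (\<eta> X)"
    and counit_in: "A \<in> Ob (Src R) \<Longrightarrow> \<epsilon> A \<in> Hom (Src R) (FOb L (FOb R A)) A"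
    and counit_natural: "\<lbrakk>A \<in> Ob (Src R); B \<in> Ob (Src R); g \<in> Hom (Src R) A B\<rbrakk>
      \<Longrightarrow> cmp (Src R) (FOb L (FOb R A)) A B g (\<epsilon> A)
        = cmp (Src R) (FOb L (FOb R A)) (FOb L (FOb R B)) B
            (\<epsilon> B) (FHom L (FOb R A) (FOb R B) (FHom R A B g))"
    and triangle_L: "X \<in> Ob (Src L) \<Longrightarrow>
        cmp (Src R) (FOb L X) (FOb L (FOb R (FOb L X))) (FOb L X)
          (\<epsilon> (FOb L X)) (FHom L X (FOb R (FOb L X)) (\<eta> X))
        = idn (Src R) (FOb L X)"
    and triangle_R: "A \<in> Ob (Src R) \<Longrightarrow>
        cmp (Src L) (FOb R A) (FOb R (FOb L (FOb R A))) (FOb R A)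
          (FHom R (FOb L (FOb R A)) A (\<epsilon> A)) (\<eta> (FOb R A))
        = idn (Src L) (FOb R A)"

definition has_left_adjoint :: "('o, 'a, 'p, 'b) func \<Rightarrow> bool" where
  "has_left_adjoint R \<longleftrightarrow> (\<exists>L \<eta> \<epsilon>. adjunction L R \<eta> \<epsilon>)"

definition has_right_adjoint :: "('o, 'a, 'p, 'b) func \<Rightarrow> bool" where
  "has_right_adjoint L \<longleftrightarrow> (\<exists>R \<eta> \<epsilon>. adjunction L R \<eta> \<epsilon>)"

section \<open>Monoidal categories and lax monoidal functors\<close>

text \<open>
  Monoidal categories are not assumed strict. The associator
  \<open>asc X Y Z : (X \<otimes> Y) \<otimes> Z \<rightarrow> X \<otimes> (Y \<otimes> Z)\<close> and the unitors \<open>lun X : I \<otimes> X \<rightarrow> X\<close>,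
  \<open>run X : X \<otimes> I \<rightarrow> X\<close> are recorded together with their (uniquely determined) inverses
  \<open>asci\<close>, \<open>luni\<close>, \<open>runi\<close>, since passing to the opposite category exchanges the two.
  For \<open>f : X \<rightarrow> X'\<close> and \<open>g : Y \<rightarrow> Y'\<close>, \<open>thom X X' Y Y' f g\<close> is \<open>f \<otimes> g\<close>.
\<close>

record ('o, 'a) moncat =
  cat_of :: "('o, 'a) cat"
  tob  :: "'o \<Rightarrow> 'o \<Rightarrow> 'o" (infixl "\<otimes>\<index>" 70)
  thom :: "'o \<Rightarrow> 'o \<Rightarrow> 'o \<Rightarrow> 'o \<Rightarrow> 'a \<Rightarrow> 'a \<Rightarrow> 'a"
  unt  :: "'o" ("\<I>\<index>")
  asc  :: "'o \<Rightarrow> 'o \<Rightarrow> 'o \<Rightarrow> 'a"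
  asci :: "'o \<Rightarrow> 'o \<Rightarrow> 'o \<Rightarrow> 'a"
  lun  :: "'o \<Rightarrow> 'a"
  luni :: "'o \<Rightarrow> 'a"
  run  :: "'o \<Rightarrow> 'a"
  runi :: "'o \<Rightarrow> 'a"

definition mutually_inverse :: "('o, 'a) cat \<Rightarrow> 'o \<Rightarrow> 'o \<Rightarrow> 'a \<Rightarrow> 'a \<Rightarrow> bool" where
  "mutually_inverse C X Y f g \<longleftrightarrow> f \<in> Hom C X Y \<and> g \<in> Hom C Y X
     \<and> cmp C X Y X g f = idn C X \<and> cmp C Y X Y f g = idn C Y"

locale monoidal_category =
  fixes M :: "('o, 'a) moncat" (structure)
    and C :: "('o, 'a) cat"
  defines "C \<equiv> cat_of M"
  assumes category: "category C"
    and tob_in: "\<lbrakk>X \<in> Ob C; Y \<in> Ob C\<rbrakk> \<Longrightarrow> X \<otimes> Y \<in> Ob C"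
    and unt_in: "\<I> \<in> Ob C"
    and thom_in: "\<lbrakk>X \<in> Ob C; X' \<in> Ob C; Y \<in> Ob C; Y' \<in> Ob C; f \<in> Hom C X X'; g \<in> Hom C Y Y'\<rbrakk>
      \<Longrightarrow> thom M X X' Y Y' f g \<in> Hom C (X \<otimes> Y) (X' \<otimes> Y')"
    and thom_idn: "\<lbrakk>X \<in> Ob C; Y \<in> Ob C\<rbrakk>
      \<Longrightarrow> thom M X X Y Y (idn C X) (idn C Y) = idn C (X \<otimes> Y)"
    and thom_cmp: "\<lbrakk>X \<in> Ob C; X' \<in> Ob C; X'' \<in> Ob C; Y \<in> Ob C; Y' \<in> Ob C; Y'' \<in> Ob C;
        f \<in> Hom C X X'; f' \<in> Hom C X' X''; g \<in> Hom C Y Y'; g' \<in> Hom C Y' Y''\<rbrakk>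
      \<Longrightarrow> thom M X X'' Y Y'' (cmp C X X' X'' f' f) (cmp C Y Y' Y'' g' g)
        = cmp C (X \<otimes> Y) (X' \<otimes> Y') (X'' \<otimes> Y'') (thom M X' X'' Y' Y'' f' g') (thom M X X' Y Y' f g)"
    and asc_inverse: "\<lbrakk>X \<in> Ob C; Y \<in> Ob C; Z \<in> Ob C\<rbrakk>
      \<Longrightarrow> mutually_inverse C ((X \<otimes> Y) \<otimes> Z) (X \<otimes> (Y \<otimes> Z)) (asc M X Y Z) (asci M X Y Z)"
    and lun_inverse: "X \<in> Ob C \<Longrightarrow> mutually_inverse C (\<I> \<otimes> X) X (lun M X) (luni M X)"
    and run_inverse: "X \<in> Ob C \<Longrightarrow> mutually_inverse C (X \<otimes> \<I>) X (run M X) (runi M X)"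
    and asc_natural: "\<lbrakk>X \<in> Ob C; X' \<in> Ob C; Y \<in> Ob C; Y' \<in> Ob C; Z \<in> Ob C; Z' \<in> Ob C;
        f \<in> Hom C X X'; g \<in> Hom C Y Y'; h \<in> Hom C Z Z'\<rbrakk>
      \<Longrightarrow> cmp C ((X \<otimes> Y) \<otimes> Z) ((X' \<otimes> Y') \<otimes> Z') (X' \<otimes> (Y' \<otimes> Z')) (asc M X' Y' Z')
            (thom M (X \<otimes> Y) (X' \<otimes> Y') Z Z' (thom M X X' Y Y' f g) h)
        = cmp C ((X \<otimes> Y) \<otimes> Z) (X \<otimes> (Y \<otimes> Z)) (X' \<otimes> (Y' \<otimes> Z'))
            (thom M X X' (Y \<otimes> Z) (Y' \<otimes> Z') f (thom M Y Y' Z Z' g h)) (asc M X Y Z)"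
    and lun_natural: "\<lbrakk>X \<in> Ob C; X' \<in> Ob C; f \<in> Hom C X X'\<rbrakk>
      \<Longrightarrow> cmp C (\<I> \<otimes> X) (\<I> \<otimes> X') X' (lun M X') (thom M \<I> \<I> X X' (idn C \<I>) f)
        = cmp C (\<I> \<otimes> X) X X' f (lun M X)"
    and run_natural: "\<lbrakk>X \<in> Ob C; X' \<in> Ob C; f \<in> Hom C X X'\<rbrakk>
      \<Longrightarrow> cmp C (X \<otimes> \<I>) (X' \<otimes> \<I>) X' (run M X') (thom M X X' \<I> \<I> f (idn C \<I>))
        = cmp C (X \<otimes> \<I>) X X' f (run M X)"
    and pentagon: "\<lbrakk>W \<in> Ob C; X \<in> Ob C; Y \<in> Ob C; Z \<in> Ob C\<rbrakk>
      \<Longrightarrow> cmp C (((W \<otimes> X) \<otimes> Y) \<otimes> Z) ((W \<otimes> X) \<otimes> (Y \<otimes> Z)) (W \<otimes> (X \<otimes> (Y \<otimes> Z)))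
            (asc M W X (Y \<otimes> Z)) (asc M (W \<otimes> X) Y Z)
        = cmp C (((W \<otimes> X) \<otimes> Y) \<otimes> Z) (W \<otimes> ((X \<otimes> Y) \<otimes> Z)) (W \<otimes> (X \<otimes> (Y \<otimes> Z)))
            (thom M W W ((X \<otimes> Y) \<otimes> Z) (X \<otimes> (Y \<otimes> Z)) (idn C W) (asc M X Y Z))
            (cmp C (((W \<otimes> X) \<otimes> Y) \<otimes> Z) ((W \<otimes> (X \<otimes> Y)) \<otimes> Z) (W \<otimes> ((X \<otimes> Y) \<otimes> Z))
              (asc M W (X \<otimes> Y) Z)
              (thom M ((W \<otimes> X) \<otimes> Y) (W \<otimes> (X \<otimes> Y)) Z Z (asc M W X Y) (idn C Z)))"
    and triangle: "\<lbrakk>X \<in> Ob C; Y \<in> Ob C\<rbrakk>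
      \<Longrightarrow> cmp C ((X \<otimes> \<I>) \<otimes> Y) (X \<otimes> (\<I> \<otimes> Y)) (X \<otimes> Y)
            (thom M X X (\<I> \<otimes> Y) Y (idn C X) (lun M Y)) (asc M X \<I> Y)
        = thom M (X \<otimes> \<I>) X Y Y (run M X) (idn C Y)"

definition op_mon :: "('o, 'a) moncat \<Rightarrow> ('o, 'a) moncat" where
  "op_mon M = \<lparr>cat_of = op_cat (cat_of M), tob = tob M,
     thom = (\<lambda>X X' Y Y' f g. thom M X' X Y' Y f g), unt = \<I>\<^bsub>M\<^esub>,
     asc = asci M, asci = asc M, lun = luni M, luni = lun M, run = runi M, runi = run M\<rparr>"

text \<open>
  \<open>\<phi>2 X Y : F X \<otimes> F Y \<rightarrow> F (X \<otimes> Y)\<close> and \<open>\<phi>0 : I \<rightarrow> F I\<close>.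
\<close>

locale lax_monoidal =
  fixes A :: "('o, 'a) moncat"
    and B :: "('p, 'b) moncat"
    and F :: "('o, 'a, 'p, 'b) func"
    and \<phi>2 :: "'o \<Rightarrow> 'o \<Rightarrow> 'b"
    and \<phi>0 :: "'b"
    and D :: "('p, 'b) cat"
  defines "D \<equiv> cat_of B"
  assumes monoidal_A: "monoidal_category A"
    and monoidal_B: "monoidal_category B"
    and functor_F: "is_functor F"
    and Src_F: "Src F = cat_of A"
    and Trg_F: "Trg F = D"
    and \<phi>2_in: "\<lbrakk>X \<in> Ob (cat_of A); Y \<in> Ob (cat_of A)\<rbrakk>
      \<Longrightarrow> \<phi>2 X Y \<in> Hom D (FOb F X \<otimes>\<^bsub>B\<^esub> FOb F Y) (FOb F (X \<otimes>\<^bsub>A\<^esub> Y))"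
    and \<phi>0_in: "\<phi>0 \<in> Hom D \<I>\<^bsub>B\<^esub> (FOb F \<I>\<^bsub>A\<^esub>)"
    and \<phi>2_natural: "\<lbrakk>X \<in> Ob (cat_of A); X' \<in> Ob (cat_of A); Y \<in> Ob (cat_of A); Y' \<in> Ob (cat_of A);
        f \<in> Hom (cat_of A) X X'; g \<in> Hom (cat_of A) Y Y'\<rbrakk>
      \<Longrightarrow> cmp D (FOb F X \<otimes>\<^bsub>B\<^esub> FOb F Y) (FOb F X' \<otimes>\<^bsub>B\<^esub> FOb F Y') (FOb F (X' \<otimes>\<^bsub>A\<^esub> Y')) (\<phi>2 X' Y')
            (thom B (FOb F X) (FOb F X') (FOb F Y) (FOb F Y') (FHom F X X' f) (FHom F Y Y' g))
        = cmp D (FOb F X \<otimes>\<^bsub>B\<^esub> FOb F Y) (FOb F (X \<otimes>\<^bsub>A\<^esub> Y)) (FOb F (X' \<otimes>\<^bsub>A\<^esub> Y'))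
            (FHom F (X \<otimes>\<^bsub>A\<^esub> Y) (X' \<otimes>\<^bsub>A\<^esub> Y') (thom A X X' Y Y' f g)) (\<phi>2 X Y)"
    and \<phi>2_assoc: "\<lbrakk>X \<in> Ob (cat_of A); Y \<in> Ob (cat_of A); Z \<in> Ob (cat_of A)\<rbrakk>
      \<Longrightarrow> cmp D ((FOb F X \<otimes>\<^bsub>B\<^esub> FOb F Y) \<otimes>\<^bsub>B\<^esub> FOb F Z)
              (FOb F ((X \<otimes>\<^bsub>A\<^esub> Y) \<otimes>\<^bsub>A\<^esub> Z)) (FOb F (X \<otimes>\<^bsub>A\<^esub> (Y \<otimes>\<^bsub>A\<^esub> Z)))
            (FHom F ((X \<otimes>\<^bsub>A\<^esub> Y) \<otimes>\<^bsub>A\<^esub> Z) (X \<otimes>\<^bsub>A\<^esub> (Y \<otimes>\<^bsub>A\<^esub> Z)) (asc A X Y Z))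
            (cmp D ((FOb F X \<otimes>\<^bsub>B\<^esub> FOb F Y) \<otimes>\<^bsub>B\<^esub> FOb F Z)
                (FOb F (X \<otimes>\<^bsub>A\<^esub> Y) \<otimes>\<^bsub>B\<^esub> FOb F Z) (FOb F ((X \<otimes>\<^bsub>A\<^esub> Y) \<otimes>\<^bsub>A\<^esub> Z))
              (\<phi>2 (X \<otimes>\<^bsub>A\<^esub> Y) Z)
              (thom B (FOb F X \<otimes>\<^bsub>B\<^esub> FOb F Y) (FOb F (X \<otimes>\<^bsub>A\<^esub> Y)) (FOb F Z) (FOb F Z)
                (\<phi>2 X Y) (idn D (FOb F Z))))
        = cmp D ((FOb F X \<otimes>\<^bsub>B\<^esub> FOb F Y) \<otimes>\<^bsub>B\<^esub> FOb F Z)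
              (FOb F X \<otimes>\<^bsub>B\<^esub> FOb F (Y \<otimes>\<^bsub>A\<^esub> Z)) (FOb F (X \<otimes>\<^bsub>A\<^esub> (Y \<otimes>\<^bsub>A\<^esub> Z)))
            (\<phi>2 X (Y \<otimes>\<^bsub>A\<^esub> Z))
            (cmp D ((FOb F X \<otimes>\<^bsub>B\<^esub> FOb F Y) \<otimes>\<^bsub>B\<^esub> FOb F Z)
                (FOb F X \<otimes>\<^bsub>B\<^esub> (FOb F Y \<otimes>\<^bsub>B\<^esub> FOb F Z)) (FOb F X \<otimes>\<^bsub>B\<^esub> FOb F (Y \<otimes>\<^bsub>A\<^esub> Z))
              (thom B (FOb F X) (FOb F X) (FOb F Y \<otimes>\<^bsub>B\<^esub> FOb F Z) (FOb F (Y \<otimes>\<^bsub>A\<^esub> Z))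
                (idn D (FOb F X)) (\<phi>2 Y Z))
              (asc B (FOb F X) (FOb F Y) (FOb F Z)))"
    and \<phi>0_left: "X \<in> Ob (cat_of A)
      \<Longrightarrow> cmp D (\<I>\<^bsub>B\<^esub> \<otimes>\<^bsub>B\<^esub> FOb F X) (FOb F (\<I>\<^bsub>A\<^esub> \<otimes>\<^bsub>A\<^esub> X)) (FOb F X)
            (FHom F (\<I>\<^bsub>A\<^esub> \<otimes>\<^bsub>A\<^esub> X) X (lun A X))
            (cmp D (\<I>\<^bsub>B\<^esub> \<otimes>\<^bsub>B\<^esub> FOb F X) (FOb F \<I>\<^bsub>A\<^esub> \<otimes>\<^bsub>B\<^esub> FOb F X) (FOb F (\<I>\<^bsub>A\<^esub> \<otimes>\<^bsub>A\<^esub> X))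
              (\<phi>2 \<I>\<^bsub>A\<^esub> X)
              (thom B \<I>\<^bsub>B\<^esub> (FOb F \<I>\<^bsub>A\<^esub>) (FOb F X) (FOb F X) \<phi>0 (idn D (FOb F X))))
        = lun B (FOb F X)"
    and \<phi>0_right: "X \<in> Ob (cat_of A)
      \<Longrightarrow> cmp D (FOb F X \<otimes>\<^bsub>B\<^esub> \<I>\<^bsub>B\<^esub>) (FOb F (X \<otimes>\<^bsub>A\<^esub> \<I>\<^bsub>A\<^esub>)) (FOb F X)
            (FHom F (X \<otimes>\<^bsub>A\<^esub> \<I>\<^bsub>A\<^esub>) X (run A X))
            (cmp D (FOb F X \<otimes>\<^bsub>B\<^esub> \<I>\<^bsub>B\<^esub>) (FOb F X \<otimes>\<^bsub>B\<^esub> FOb F \<I>\<^bsub>A\<^esub>) (FOb F (X \<otimes>\<^bsub>A\<^esub> \<I>\<^bsub>A\<^esub>))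
              (\<phi>2 X \<I>\<^bsub>A\<^esub>)
              (thom B (FOb F X) (FOb F X) \<I>\<^bsub>B\<^esub> (FOb F \<I>\<^bsub>A\<^esub>) (idn D (FOb F X)) \<phi>0))
        = run B (FOb F X)"

section \<open>Algebras and coalgebras\<close>

text \<open>
  An algebra is a triple \<open>(X, m, u)\<close> with \<open>m : X \<otimes> X \<rightarrow> X\<close> and \<open>u : I \<rightarrow> X\<close>; a coalgebra
  is a triple \<open>(X, d, e)\<close> with \<open>d : X \<rightarrow> X \<otimes> X\<close> and \<open>e : X \<rightarrow> I\<close>.
\<close>

definition is_alg :: "('o, 'a) moncat \<Rightarrow> 'o \<Rightarrow> 'a \<Rightarrow> 'a \<Rightarrow> bool" where
  "is_alg M X m u \<longleftrightarrow> (let C = cat_of M; T = tob M; I = unt M in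
     X \<in> Ob C \<and> m \<in> Hom C (T X X) X \<and> u \<in> Hom C I X
     \<and> cmp C (T (T X X) X) (T X X) X m (thom M (T X X) X X X m (idn C X))
       = cmp C (T (T X X) X) (T X X) X m
           (cmp C (T (T X X) X) (T X (T X X)) (T X X)
             (thom M X X (T X X) X (idn C X) m) (asc M X X X))
     \<and> cmp C (T I X) (T X X) X m (thom M I X X X u (idn C X)) = lun M X
     \<and> cmp C (T X I) (T X X) X m (thom M X X I X (idn C X) u) = run M X)"

definition is_coalg :: "('o, 'a) moncat \<Rightarrow> 'o \<Rightarrow> 'a \<Rightarrow> 'a \<Rightarrow> bool" where
  "is_coalg M X d e \<longleftrightarrow> (let C = cat_of M; T = tob M; I = unt M in
     X \<in> Ob C \<and> d \<in> Hom C X (T X X) \<and> e \<in> Hom C X I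
     \<and> cmp C X (T (T X X) X) (T X (T X X)) (asc M X X X)
           (cmp C X (T X X) (T (T X X) X) (thom M X (T X X) X X d (idn C X)) d)
       = cmp C X (T X X) (T X (T X X)) (thom M X X X (T X X) (idn C X) d) d
     \<and> cmp C X (T X X) (T I X) (thom M X I X X e (idn C X)) d = luni M X
     \<and> cmp C X (T X X) (T X I) (thom M X X X I (idn C X) e) d = runi M X)"

definition Alg :: "('o, 'a) moncat \<Rightarrow> ('o \<times> 'a \<times> 'a, 'a) cat" where
  "Alg M = (let C = cat_of M in
    \<lparr>Ob = {(X, m, u). is_alg M X m u},
     Hom = (\<lambda>(X, m, u) (X', m', u'). {f \<in> Hom C X X'.
        cmp C (X \<otimes>\<^bsub>M\<^esub> X) X X' f m
          = cmp C (X \<otimes>\<^bsub>M\<^esub> X) (X' \<otimes>\<^bsub>M\<^esub> X') X' m' (thom M X X' X X' f f)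
        \<and> cmp C \<I>\<^bsub>M\<^esub> X X' f u = u'}),
     idn = (\<lambda>(X, _). idn C X),
     cmp = (\<lambda>(X, _) (Y, _) (Z, _). cmp C X Y Z)\<rparr>)"

definition Coalg :: "('o, 'a) moncat \<Rightarrow> ('o \<times> 'a \<times> 'a, 'a) cat" where
  "Coalg M = (let C = cat_of M in
    \<lparr>Ob = {(X, d, e). is_coalg M X d e},
     Hom = (\<lambda>(X, d, e) (X', d', e'). {f \<in> Hom C X X'.
        cmp C X X' (X' \<otimes>\<^bsub>M\<^esub> X') d' f
          = cmp C X (X \<otimes>\<^bsub>M\<^esub> X) (X' \<otimes>\<^bsub>M\<^esub> X') (thom M X X' X X' f f) d
        \<and> cmp C X X' \<I>\<^bsub>M\<^esub> e' f = e}),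
     idn = (\<lambda>(X, _). idn C X),
     cmp = (\<lambda>(X, _) (Y, _) (Z, _). cmp C X Y Z)\<rparr>)"

text \<open>The functor \<open>Alg(F)\<close> induced by \<open>F : A \<rightarrow> B\<close> with lax monoidal structure \<open>\<phi>2\<close>, \<open>\<phi>0\<close>.\<close>

definition alg_functor :: "('o, 'a) moncat \<Rightarrow> ('p, 'b) moncat \<Rightarrow> ('o, 'a, 'p, 'b) func
    \<Rightarrow> ('o \<Rightarrow> 'o \<Rightarrow> 'b) \<Rightarrow> 'b \<Rightarrow> ('o \<times> 'a \<times> 'a, 'a, 'p \<times> 'b \<times> 'b, 'b) func" where
  "alg_functor A B F \<phi>2 \<phi>0 = (let D = cat_of B in
    \<lparr>Src = Alg A, Trg = Alg B,
     FOb = (\<lambda>(X, m, u). (FOb F X,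
        cmp D (FOb F X \<otimes>\<^bsub>B\<^esub> FOb F X) (FOb F (X \<otimes>\<^bsub>A\<^esub> X)) (FOb F X)
          (FHom F (X \<otimes>\<^bsub>A\<^esub> X) X m) (\<phi>2 X X),
        cmp D \<I>\<^bsub>B\<^esub> (FOb F \<I>\<^bsub>A\<^esub>) (FOb F X) (FHom F \<I>\<^bsub>A\<^esub> X u) \<phi>0)),
     FHom = (\<lambda>(X, _) (Y, _). FHom F X Y)\<rparr>)"

text \<open>
  The functor \<open>Coalg(F)\<close> induced by \<open>F : A \<rightarrow> B\<close> with colax monoidal structure
  \<open>\<psi>2 X Y : F (X \<otimes> Y) \<rightarrow> F X \<otimes> F Y\<close>, \<open>\<psi>0 : F I \<rightarrow> I\<close>.
\<close>

definition coalg_functor :: "('o, 'a) moncat \<Rightarrow> ('p, 'b) moncat \<Rightarrow> ('o, 'a, 'p, 'b) func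
    \<Rightarrow> ('o \<Rightarrow> 'o \<Rightarrow> 'b) \<Rightarrow> 'b \<Rightarrow> ('o \<times> 'a \<times> 'a, 'a, 'p \<times> 'b \<times> 'b, 'b) func" where
  "coalg_functor A B F \<psi>2 \<psi>0 = (let D = cat_of B in
    \<lparr>Src = Coalg A, Trg = Coalg B,
     FOb = (\<lambda>(X, d, e). (FOb F X,
        cmp D (FOb F X) (FOb F (X \<otimes>\<^bsub>A\<^esub> X)) (FOb F X \<otimes>\<^bsub>B\<^esub> FOb F X)
          (\<psi>2 X X) (FHom F X (X \<otimes>\<^bsub>A\<^esub> X) d),
        cmp D (FOb F X) (FOb F \<I>\<^bsub>A\<^esub>) \<I>\<^bsub>B\<^esub> \<psi>0 (FHom F X \<I>\<^bsub>A\<^esub> e))),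
     FHom = (\<lambda>(X, _) (Y, _). FHom F X Y)\<rparr>)"

section \<open>Liftable adjunctions\<close>

text \<open>
  For a lax monoidal \<open>R : A \<rightarrow> B\<close> with left adjoint \<open>L\<close>, the colax monoidal structure that the
  adjunction induces on \<open>L : B \<rightarrow> A\<close>:
  \<open>\<psi>2 X Y = \<epsilon> (L X \<otimes> L Y) \<circ> L (\<phi>2 (L X) (L Y)) \<circ> L (\<eta> X \<otimes> \<eta> Y)\<close> and \<open>\<psi>0 = \<epsilon> I \<circ> L \<phi>0\<close>.
\<close>

definition induced_\<psi>2 :: "('o, 'a) moncat \<Rightarrow> ('p, 'b) moncat
    \<Rightarrow> ('p, 'b, 'o, 'a) func \<Rightarrow> ('o, 'a, 'p, 'b) func \<Rightarrow> ('p \<Rightarrow> 'b) \<Rightarrow> ('o \<Rightarrow> 'a)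
    \<Rightarrow> ('o \<Rightarrow> 'o \<Rightarrow> 'b) \<Rightarrow> 'p \<Rightarrow> 'p \<Rightarrow> 'a" where
  "induced_\<psi>2 A B L R \<eta> \<epsilon> \<phi>2 X Y =
    (let LXY = FOb L (X \<otimes>\<^bsub>B\<^esub> Y); LX = FOb L X; LY = FOb L Y;
         RLX = FOb R LX; RLY = FOb R LY; T = LX \<otimes>\<^bsub>A\<^esub> LY
     in cmp (cat_of A) LXY (FOb L (FOb R T)) T
          (\<epsilon> T)
          (cmp (cat_of A) LXY (FOb L (RLX \<otimes>\<^bsub>B\<^esub> RLY)) (FOb L (FOb R T))
            (FHom L (RLX \<otimes>\<^bsub>B\<^esub> RLY) (FOb R T) (\<phi>2 LX LY))
            (FHom L (X \<otimes>\<^bsub>B\<^esub> Y) (RLX \<otimes>\<^bsub>B\<^esub> RLY) (thom B X RLX Y RLY (\<eta> X) (\<eta> Y)))))"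

definition induced_\<psi>0 :: "('o, 'a) moncat \<Rightarrow> ('p, 'b) moncat
    \<Rightarrow> ('p, 'b, 'o, 'a) func \<Rightarrow> ('o, 'a, 'p, 'b) func \<Rightarrow> ('o \<Rightarrow> 'a) \<Rightarrow> 'b \<Rightarrow> 'a" where
  "induced_\<psi>0 A B L R \<epsilon> \<phi>0 =
     cmp (cat_of A) (FOb L \<I>\<^bsub>B\<^esub>) (FOb L (FOb R \<I>\<^bsub>A\<^esub>)) \<I>\<^bsub>A\<^esub>
       (\<epsilon> \<I>\<^bsub>A\<^esub>) (FHom L \<I>\<^bsub>B\<^esub> (FOb R \<I>\<^bsub>A\<^esub>) \<phi>0)"

definition liftable :: "('o, 'a) moncat \<Rightarrow> ('p, 'b) moncat
    \<Rightarrow> ('p, 'b, 'o, 'a) func \<Rightarrow> ('o, 'a, 'p, 'b) func \<Rightarrow> ('p \<Rightarrow> 'b) \<Rightarrow> ('o \<Rightarrow> 'a)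
    \<Rightarrow> ('o \<Rightarrow> 'o \<Rightarrow> 'b) \<Rightarrow> 'b \<Rightarrow> bool" where
  "liftable A B L R \<eta> \<epsilon> \<phi>2 \<phi>0 \<longleftrightarrow>
     lax_monoidal A B R \<phi>2 \<phi>0 \<and> adjunction L R \<eta> \<epsilon>
     \<and> has_left_adjoint (alg_functor A B R \<phi>2 \<phi>0)
     \<and> has_right_adjoint (coalg_functor B A L
          (induced_\<psi>2 A B L R \<eta> \<epsilon> \<phi>2) (induced_\<psi>0 A B L R \<epsilon> \<phi>0))"

end

theory Submission
  imports Defs
begin

text \<open>
  Reversing arrows turns algebras into coalgebras, so \<open>R = L\<^sup>o\<^sup>p\<close> with matching structure maps gives
  \<open>Alg(R) = Coalg(L)\<^sup>o\<^sup>p\<close>. A left adjoint of \<open>Alg(R)\<close> then becomes, on passing to opposites,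
  a right adjoint of \<open>Coalg(L)\<close>.
\<close>

lemma op_cat_simps [simp]:
  "Ob (op_cat C) = Ob C"
  "Hom (op_cat C) X Y = Hom C Y X"
  "idn (op_cat C) = idn C"
  "cmp (op_cat C) X Y Z g f = cmp C Z Y X f g"
  by (simp_all add: op_cat_def)

lemma op_cat_op_cat [simp]: "op_cat (op_cat C) = C"
  by (simp add: op_cat_def)

lemma op_fun_simps [simp]:
  "Src (op_fun F) = op_cat (Src F)"
  "Trg (op_fun F) = op_cat (Trg F)"
  "FOb (op_fun F) = FOb F"
  "FHom (op_fun F) X Y f = FHom F Y X f"
  by (simp_all add: op_fun_def)

lemma op_fun_op_fun [simp]: "op_fun (op_fun F) = F"
  by (simp add: op_fun_def)

lemma op_mon_simps [simp]:
  "cat_of (op_mon M) = op_cat (cat_of M)"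
  "tob (op_mon M) = tob M"
  "thom (op_mon M) X X' Y Y' f g = thom M X' X Y' Y f g"
  "unt (op_mon M) = unt M"
  "asc (op_mon M) = asci M"
  "asci (op_mon M) = asc M"
  "lun (op_mon M) = luni M"
  "luni (op_mon M) = lun M"
  "run (op_mon M) = runi M"
  "runi (op_mon M) = run M"
  by (simp_all add: op_mon_def)

lemma op_mon_op_mon [simp]: "op_mon (op_mon M) = M"
  by (simp add: op_mon_def)

lemma category_op_cat: "category C \<Longrightarrow> category (op_cat C)"
  unfolding category_def by simp

lemma is_functor_op_fun: "is_functor F \<Longrightarrow> is_functor (op_fun F)"
  unfolding is_functor_def by (simp add: category_op_cat)

lemma func_eq_op_fun: "func_eq F G \<Longrightarrow> func_eq (op_fun F) (op_fun G)"
  unfolding func_eq_def by auto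

text \<open>The functor axioms evaluate a functor only on objects and arrows of its source, and
  \<open>func_eq\<close> controls exactly those values.\<close>

lemma is_functor_func_eq:
  assumes "is_functor F" and eq: "func_eq F G"
  shows "is_functor G"
proof -
  interpret F: is_functor F by fact
  \<comment> \<open>Identities and composites are then arrows of the source, so agreement of
    \<open>F\<close> and \<open>G\<close> applies to them too.\<close>
  interpret S: category "Src F" by (rule F.category_Src)
  have [simp]: "Src G = Src F" "Trg G = Trg F"
    using eq by (simp_all add: func_eq_def)
  have ob [simp]: "FOb G X = FOb F X" if "X \<in> Ob (Src F)" for X
    using eq that by (simp add: func_eq_def)
  have hom [simp]: "FHom G X Y f = FHom F X Y f"
    if "X \<in> Ob (Src F)" "Y \<in> Ob (Src F)" "f \<in> Hom (Src F) X Y" for X Y f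
    using eq that by (simp add: func_eq_def)
  show ?thesis
    by (rule is_functor.intro)
      (simp_all add: F.category_Src F.category_Trg F.FOb_in F.FHom_in F.FHom_idn F.FHom_cmp
        S.idn_in S.cmp_in)
qed

text \<open>Reversing all arrows makes the counit a unit and the unit a counit, and turns each
  triangle identity into the other.\<close>

lemma adjunction_op_fun:
  assumes "adjunction L R \<eta> \<epsilon>"
  shows "adjunction (op_fun R) (op_fun L) \<epsilon> \<eta>"
proof -
  interpret adjunction L R \<eta> \<epsilon> by fact
  show ?thesis
    by (rule adjunction.intro)
      (simp_all add: is_functor_op_fun functor_L functor_R Src_L Trg_L
        unit_in [unfolded Src_L] counit_in unit_natural [unfolded Src_L] counit_natural
        triangle_L [unfolded Src_L] triangle_R [unfolded Src_L])
qed

text \<open>The same unit and counit serve for \<open>L'\<close>.\<close>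

lemma adjunction_func_eq_left:
  assumes "adjunction L R \<eta> \<epsilon>" and eq: "func_eq L L'"
  shows "adjunction L' R \<eta> \<epsilon>"
proof -
  interpret adjunction L R \<eta> \<epsilon> by fact
  interpret L: is_functor L by (rule functor_L)
  interpret R: is_functor R by (rule functor_R)
  have [simp]: "Src L' = Src L" "Trg L' = Trg L"
    using eq by (simp_all add: func_eq_def)
  have [simp]: "FOb L' X = FOb L X" if "X \<in> Ob (Src L)" for X
    using eq that by (simp add: func_eq_def)
  have [simp]: "FHom L' X Y f = FHom L X Y f"
    if "X \<in> Ob (Src L)" "Y \<in> Ob (Src L)" "f \<in> Hom (Src L) X Y" for X Y f
    using eq that by (simp add: func_eq_def)
  \<comment> \<open>These closure facts allow \<open>L'\<close> to be replaced by \<open>L\<close>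
    also inside composites such as \<open>L' (R g)\<close>.\<close>
  have [simp]: "FOb R A \<in> Ob (Src L)" if "A \<in> Ob (Src R)" for A
    using R.FOb_in that by (simp add: Src_L)
  have [simp]: "FOb L X \<in> Ob (Src R)" if "X \<in> Ob (Src L)" for X
    using L.FOb_in that by (simp add: Trg_L)
  have [simp]: "FHom R A B g \<in> Hom (Src L) (FOb R A) (FOb R B)"
    if "A \<in> Ob (Src R)" "B \<in> Ob (Src R)" "g \<in> Hom (Src R) A B" for A B g
    using R.FHom_in that by (simp add: Src_L)
  show ?thesis
  proof (rule adjunction.intro)
    show "is_functor L'" using functor_L eq by (rule is_functor_func_eq)
    show "is_functor R" by (rule functor_R)
    show "Src L' = Trg R" "Trg L' = Src R" by (simp_all add: Src_L Trg_L)
  qed (simp_all add: unit_in counit_in unit_natural counit_natural triangle_L triangle_R)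
qed

lemma has_right_adjoint_op_fun:
  "has_left_adjoint R \<Longrightarrow> has_right_adjoint (op_fun R)"
  unfolding has_left_adjoint_def has_right_adjoint_def by (blast intro: adjunction_op_fun)

lemma has_right_adjoint_func_eq:
  "has_right_adjoint L \<Longrightarrow> func_eq L L' \<Longrightarrow> has_right_adjoint L'"
  unfolding has_right_adjoint_def by (blast intro: adjunction_func_eq_left)

text \<open>Used to carry the associator from one side of the associativity law to the
  other.\<close>

lemma (in category) mutually_inverse_cancel:
  assumes inv: "mutually_inverse C X Y f g"
    and "W \<in> Ob C" "X \<in> Ob C" "Y \<in> Ob C" "h \<in> Hom C W X" "k \<in> Hom C W Y"
  shows "h = cmp C W Y X g k \<longleftrightarrow> cmp C W X Y f h = k"
proof -
  have f: "f \<in> Hom C X Y" and g: "g \<in> Hom C Y X"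
    and gf: "cmp C X Y X g f = idn C X" and fg: "cmp C Y X Y f g = idn C Y"
    using inv by (simp_all add: mutually_inverse_def)
  have "cmp C W Y X g (cmp C W X Y f h) = h"
    using cmp_assoc [of W X Y X h f g] assms f g gf by (simp add: cmp_idn_left)
  moreover have "cmp C W X Y f (cmp C W Y X g k) = k"
    using cmp_assoc [of W Y X Y k g f] assms f g fg by (simp add: cmp_idn_left)
  ultimately show ?thesis by auto
qed

text \<open>
  The two associativity laws differ by moving the associator to the other side of the equation.
\<close>

lemma is_alg_op_mon:
  assumes "monoidal_category M"
  shows "is_alg (op_mon M) X d e \<longleftrightarrow> is_coalg M X d e"
\<comment> \<open>If the typing of \<open>X\<close> or \<open>d\<close> fails, both sides are false;
  only the well-typed case needs the monoidal axioms.\<close>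
proof (cases "X \<in> Ob (cat_of M) \<and> d \<in> Hom (cat_of M) X (tob M X X)")
  case True
  interpret monoidal_category M "cat_of M" by fact simp
  interpret category "cat_of M" by (rule category)
  let ?C = "cat_of M" and ?T = "tob M"
  have X: "X \<in> Ob ?C" "?T X X \<in> Ob ?C" "?T (?T X X) X \<in> Ob ?C" "?T X (?T X X) \<in> Ob ?C"
    and d: "d \<in> Hom ?C X (?T X X)"
    using True by (simp_all add: tob_in)
  have a: "asci M X X X \<in> Hom ?C (?T X (?T X X)) (?T (?T X X) X)"
    using asc_inverse [of X X X] X by (simp add: mutually_inverse_def)
  have l: "thom M X (?T X X) X X d (idn ?C X) \<in> Hom ?C (?T X X) (?T (?T X X) X)"
    and r: "thom M X X X (?T X X) (idn ?C X) d \<in> Hom ?C (?T X X) (?T X (?T X X))"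
    using X d by (simp_all add: thom_in idn_in)
  \<comment> \<open>Read in \<open>M\<close>, the algebra law for \<open>op_mon M\<close> attaches
    \<open>asci\<close> to \<open>1 \<otimes> d\<close> before composing with \<open>d\<close>.
    Rebracketing puts \<open>asci\<close> outermost, where it can be cancelled.\<close>
  have "cmp ?C X (?T X X) (?T (?T X X) X)
      (cmp ?C (?T X X) (?T X (?T X X)) (?T (?T X X) X)
        (asci M X X X) (thom M X X X (?T X X) (idn ?C X) d)) d
    = cmp ?C X (?T X (?T X X)) (?T (?T X X) X) (asci M X X X)
        (cmp ?C X (?T X X) (?T X (?T X X)) (thom M X X X (?T X X) (idn ?C X) d) d)"
    using X d a r by (intro cmp_assoc)
  then show ?thesis
    \<comment> \<open>Here \<open>h\<close> is \<open>(d \<otimes> 1) d\<close> and \<open>k\<close>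
      is \<open>(1 \<otimes> d) d\<close>.\<close>
    using mutually_inverse_cancel [OF asc_inverse [of X X X] _ _ _ cmp_in cmp_in, of X] X d l r
    by (simp add: is_alg_def is_coalg_def Let_def)
qed (auto simp add: is_alg_def is_coalg_def Let_def)

text \<open>Conditions on homomorphisms, identities and composition agree once arrows are read
  backwards; only the objects need \<open>is_alg_op_mon\<close>.\<close>

lemma Alg_op_mon:
  assumes "monoidal_category M"
  shows "Alg (op_mon M) = op_cat (Coalg M)"
  by (rule cat.equality)
    (auto simp add: Alg_def Coalg_def Let_def is_alg_op_mon [OF assms] fun_eq_iff)

text \<open>Read backwards, the multiplication \<open>R m \<circ> \<phi>2\<close> is the
  comultiplication \<open>\<psi>2 \<circ> L d\<close>. Only the components at pairs
  \<open>(X, X)\<close> enter.\<close>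

lemma alg_functor_eq_op_coalg_functor:
  assumes A: "monoidal_category A" and B: "monoidal_category B"
    and eq: "func_eq L (op_fun R)"
    and Src_L: "Src L = cat_of A"
    and \<psi>2: "\<And>X. X \<in> Ob (cat_of A) \<Longrightarrow> \<psi>2 X X = \<phi>2 X X" and \<psi>0: "\<psi>0 = \<phi>0"
  shows "func_eq (alg_functor (op_mon A) (op_mon B) R \<phi>2 \<phi>0) (op_fun (coalg_functor A B L \<psi>2 \<psi>0))"
proof -
  interpret monoidal_category A "cat_of A" by fact simp
  have [simp]: "FOb L X = FOb R X" if "X \<in> Ob (cat_of A)" for X
    using eq that Src_L by (simp add: func_eq_def)
  have [simp]: "FHom L X Y f = FHom R Y X f"
    if "X \<in> Ob (cat_of A)" "Y \<in> Ob (cat_of A)" "f \<in> Hom (cat_of A) X Y" for X Y f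
    using eq that Src_L by (simp add: func_eq_def)
  show ?thesis
    unfolding func_eq_def
    by (auto simp add: alg_functor_def coalg_functor_def Let_def Alg_op_mon A B
        Coalg_def is_coalg_def tob_in unt_in \<psi>2 \<psi>0)
qed

theorem proposition4p6:
  fixes M :: "('o, 'a) moncat"
    and R L :: "('o, 'a, 'o, 'a) func"
    and \<phi>2 :: "'o \<Rightarrow> 'o \<Rightarrow> 'a" and \<phi>0 :: 'a
    and \<eta> \<epsilon> :: "'o \<Rightarrow> 'a"
    and \<psi>2 :: "'o \<Rightarrow> 'o \<Rightarrow> 'a" and \<psi>0 :: 'a
  defines "\<psi>2 \<equiv> induced_\<psi>2 (op_mon M) M L R \<eta> \<epsilon> \<phi>2"
    and "\<psi>0 \<equiv> induced_\<psi>0 (op_mon M) M L R \<epsilon> \<phi>0"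
  assumes "monoidal_category M"
    and "lax_monoidal (op_mon M) M R \<phi>2 \<phi>0"
    and "adjunction L R \<eta> \<epsilon>"
    and "func_eq L (op_fun R)"
    and "\<And>X Y. X \<in> Ob (cat_of M) \<Longrightarrow> Y \<in> Ob (cat_of M) \<Longrightarrow> \<psi>2 X Y = \<phi>2 X Y"
    and "\<psi>0 = \<phi>0"
  shows "func_eq (alg_functor (op_mon M) M R \<phi>2 \<phi>0) (op_fun (coalg_functor M (op_mon M) L \<psi>2 \<psi>0))
    \<and> (has_left_adjoint (alg_functor (op_mon M) M R \<phi>2 \<phi>0)
        \<longrightarrow> liftable (op_mon M) M L R \<eta> \<epsilon> \<phi>2 \<phi>0)"
proof -
  interpret lax_monoidal "op_mon M" M R \<phi>2 \<phi>0 "cat_of M" by fact simp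
  have L: "Src L = cat_of M"
    using assms(6) Src_F by (simp add: func_eq_def)
  have eq: "func_eq (alg_functor (op_mon M) M R \<phi>2 \<phi>0)
      (op_fun (coalg_functor M (op_mon M) L \<psi>2 \<psi>0))"
    \<comment> \<open>Taken with \<open>A = M\<close> and \<open>B = op_mon M\<close>, so that
      \<open>op_mon B\<close> is \<open>M\<close> again; \<open>monoidal_A\<close> says that
      \<open>op_mon M\<close> is monoidal.\<close>
    using alg_functor_eq_op_coalg_functor [OF assms(3) monoidal_A assms(6) L, of \<psi>2 \<phi>2 \<psi>0 \<phi>0]
      assms(7,8) by simp
  have "has_right_adjoint (coalg_functor M (op_mon M) L \<psi>2 \<psi>0)"
    if "has_left_adjoint (alg_functor (op_mon M) M R \<phi>2 \<phi>0)"
    \<comment> \<open>The opposite of \<open>Alg(R)\<close> has a right adjoint, and by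
      \<open>eq\<close> it agrees with the double opposite of \<open>Coalg(L)\<close>, which is
      \<open>Coalg(L)\<close> itself.\<close>
    using has_right_adjoint_func_eq [OF has_right_adjoint_op_fun [OF that] func_eq_op_fun [OF eq]]
    by simp
  then show ?thesis
    using eq assms(4,5) by (simp add: liftable_def \<psi>2_def \<psi>0_def)
qed

end
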